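(* Suppose that for every prime number $p$ and every finite group $G$ with $O_{p'}(G)=1$ the group $\mathrm{Out}_{col}(G)$ is trivial. Then for every finite group $G$ with a unique minimal non-trivial normal subgroup the group $\mathrm{Out}_{col}(G)$ is trivial.
   Context: $O_{p'}(G)$ is the largest normal subgroup of $G$ of order not divisible by $p$. An automorphism $\sigma$ of a finite group $G$ is a Coleman automorphism if for any prime $p$ dividing $|G|$ and any Sylow $p$-subgroup $P$ of $G$ there exists $g\in G$ such that $\sigma|_P=\mathrm{conj}(g)|_P$, where $\mathrm{conj}(g)$ is the map $x\mapsto g^{-1}xg$. $\mathrm{Aut}_{col}(G)$ is the group of Coleman automorphisms and $\mathrm{Out}_{col}(G)=\mathrm{Aut}_{col}(G)/\mathrm{Inn}(G)$. *)

theory Defs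
  imports "HOL-Algebra.Sylow" "HOL-Algebra.Bij" "HOL-Algebra.Elementary_Groups"
    "HOL-Algebra.SndIsomorphismGrp"
begin

definition p'_core :: "nat \<Rightarrow> ('a, 'b) monoid_scheme \<Rightarrow> 'a set"
  where "p'_core p G =
    (THE N. N \<lhd> G \<and> \<not> p dvd card N \<and> (\<forall>M. M \<lhd> G \<and> \<not> p dvd card M \<longrightarrow> M \<subseteq> N))"

definition sylow_subgroup :: "nat \<Rightarrow> 'a set \<Rightarrow> ('a, 'b) monoid_scheme \<Rightarrow> bool"
  where "sylow_subgroup p P G \<longleftrightarrow> subgroup P G \<and> card P = p ^ multiplicity p (order G)"

definition conj_by :: "('a, 'b) monoid_scheme \<Rightarrow> 'a \<Rightarrow> 'a \<Rightarrow> 'a"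
  where "conj_by G g = (\<lambda>x\<in>carrier G. inv\<^bsub>G\<^esub> g \<otimes>\<^bsub>G\<^esub> x \<otimes>\<^bsub>G\<^esub> g)"

definition Inn :: "('a, 'b) monoid_scheme \<Rightarrow> ('a \<Rightarrow> 'a) set"
  where "Inn G = conj_by G ` carrier G"

text \<open>Automorphisms are the extensional functions in \<^term>\<open>auto G\<close>, so that distinct elements
  represent distinct maps on the carrier.\<close>

definition Aut_col :: "('a, 'b) monoid_scheme \<Rightarrow> ('a \<Rightarrow> 'a) set"
  where "Aut_col G = {\<sigma> \<in> auto G. \<forall>p P. prime p \<and> p dvd order G \<and> sylow_subgroup p P G \<longrightarrow>
    (\<exists>g\<in>carrier G. \<forall>x\<in>P. \<sigma> x = conj_by G g x)}"

definition AutColGroup :: "('a, 'b) monoid_scheme \<Rightarrow> ('a \<Rightarrow> 'a) monoid"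
  where "AutColGroup G = AutoGroup G \<lparr>carrier := Aut_col G\<rparr>"

definition Out_col :: "('a, 'b) monoid_scheme \<Rightarrow> ('a \<Rightarrow> 'a) set monoid"
  where "Out_col G = AutColGroup G Mod Inn G"

text \<open>A hypothesis on ``every finite group'' has to fix the type of the elements. Each finite group
  is isomorphic to one whose carrier is a finite set of natural numbers, so such a hypothesis is
  stated for all finite groups of type \<^typ>\<open>nat monoid\<close>; a conclusion on every finite group is
  stated polymorphically.\<close>

definition minimal_normal :: "'a set \<Rightarrow> ('a, 'b) monoid_scheme \<Rightarrow> bool"
  where "minimal_normal N G \<longleftrightarrow> N \<lhd> G \<and> N \<noteq> {\<one>\<^bsub>G\<^esub>} \<and>
    (\<forall>M. M \<lhd> G \<and> M \<noteq> {\<one>\<^bsub>G\<^esub>} \<and> M \<subseteq> N \<longrightarrow> M = N)"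


subsection \<open>Well-definedness of the $p'$-core\<close>

lemma (in group) p'_normal_mult:
  assumes fin: "finite (carrier G)" and p: "prime (p::nat)"
    and N: "N \<lhd> G" "\<not> p dvd card N" and M: "M \<lhd> G" "\<not> p dvd card M"
  shows "N <#> M \<lhd> G" "\<not> p dvd card (N <#> M)" "N \<subseteq> N <#> M" "M \<subseteq> N <#> M"
proof -
  have sM: "subgroup M G" using M(1) by (simp add: normal_imp_subgroup)
  interpret N: normal N G by fact
  interpret S: second_isomorphism_grp N G M
    using N.normal_axioms sM
    by (simp add: second_isomorphism_grp_def second_isomorphism_grp_axioms_def)
  show "N \<subseteq> N <#> M" by (rule S.H_contained_in_set_mult)
  show "M \<subseteq> N <#> M" by (rule S.S_contained_in_set_mult)
  have sub: "subgroup (N <#> M) G" by (rule S.normal_set_mult_subgroup)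
  show "N <#> M \<lhd> G"
    unfolding normal_inv_iff
  proof (intro conjI ballI sub)
    fix x y assume x: "x \<in> carrier G" and "y \<in> N <#> M"
    then obtain n m where nm: "n \<in> N" "m \<in> M" "y = n \<otimes> m" unfolding set_mult_def by auto
    have c: "n \<in> carrier G" "m \<in> carrier G"
      using nm N.subset subgroup.subset[OF sM] by auto
    have "x \<otimes> n \<otimes> inv x \<in> N" "x \<otimes> m \<otimes> inv x \<in> M"
      using N M nm x by (auto simp: normal_inv_iff)
    moreover have "x \<otimes> y \<otimes> inv x = (x \<otimes> n \<otimes> inv x) \<otimes> (x \<otimes> m \<otimes> inv x)"
      using x c by (simp add: nm(3) m_assoc inv_solve_left)
    ultimately show "x \<otimes> y \<otimes> inv x \<in> N <#> M" unfolding set_mult_def by blast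
  qed
  have "card (N <#> M) dvd card N * card M"
  proof -
    have "rcosets\<^bsub>G\<lparr>carrier := N <#> M\<rparr>\<^esub> N \<subseteq> (\<lambda>g. N #> g) ` M"
      using S.normal_intersection_hom_surj by (auto simp: FactGroup_def)
    interpret NM: group "G\<lparr>carrier := N <#> M\<rparr>" using subgroup_imp_group[OF sub] .
    interpret gM: group "G\<lparr>carrier := M\<rparr>" using subgroup_imp_group[OF sM] .
    have "G\<lparr>carrier := M\<rparr> Mod (N \<inter> M) \<cong> G\<lparr>carrier := N <#> M\<rparr> Mod N"
      using group_hom.FactGroup_iso[OF S.normal_intersection_hom S.normal_intersection_hom_surj]
      by (simp add: S.normal_intersection_hom_kernel)
    then have "card (rcosets\<^bsub>G\<lparr>carrier := M\<rparr>\<^esub> (N \<inter> M)) = card (rcosets\<^bsub>G\<lparr>carrier := N <#> M\<rparr>\<^esub> N)"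
      by (auto simp: is_iso_def iso_def FactGroup_def dest: bij_betw_same_card)
    moreover have "card (rcosets\<^bsub>G\<lparr>carrier := M\<rparr>\<^esub> (N \<inter> M)) * card (N \<inter> M) = card M"
      using gM.lagrange[of "N \<inter> M"] S.normal_subgrp_intersection_normal
      by (simp add: order_def Int_commute normal_imp_subgroup)
    moreover have "card (rcosets\<^bsub>G\<lparr>carrier := N <#> M\<rparr>\<^esub> N) * card N = card (N <#> M)"
      using NM.lagrange[of N] subgroup_incl[OF N.subgroup_axioms sub S.H_contained_in_set_mult]
      by (simp add: order_def)
    ultimately show ?thesis by (metis dvd_triv_left mult.commute mult_dvd_mono dvd_refl)
  qed
  then show "\<not> p dvd card (N <#> M)"
    using N(2) M(2) p by (metis dvd_trans prime_dvd_mult_iff)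
qed

lemma (in group) p'_core:
  assumes fin: "finite (carrier G)" and p: "prime p"
  shows "p'_core p G \<lhd> G" "\<not> p dvd card (p'_core p G)"
    and "\<And>M. M \<lhd> G \<Longrightarrow> \<not> p dvd card M \<Longrightarrow> M \<subseteq> p'_core p G"
proof -
  let ?S = "{N. N \<lhd> G \<and> \<not> p dvd card N}"
  have "?S \<subseteq> Pow (carrier G)" by (auto dest!: normal_imp_subgroup subgroup.subset)
  then have "finite ?S" using fin by (meson finite_Pow_iff finite_subset)
  moreover have "{\<one>} \<in> ?S"
    using p one_is_normal by (auto dest: prime_gt_1_nat)
  ultimately obtain N where N: "N \<in> ?S" and mx: "\<forall>M\<in>?S. N \<subseteq> M \<longrightarrow> N = M"
    using finite_has_maximal[of ?S] by blast
  have max: "M \<subseteq> N" if "M \<lhd> G" "\<not> p dvd card M" for M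
  proof -
    note NM = p'_normal_mult[OF fin p, of N M]
    have "N <#> M \<in> ?S" "N \<subseteq> N <#> M" using NM N that by simp_all
    then have "N = N <#> M" using mx by blast
    then show ?thesis using NM(4) N that by simp
  qed
  have "p'_core p G = N"
    unfolding p'_core_def
  proof (rule the_equality)
    show "N \<lhd> G \<and> \<not> p dvd card N \<and> (\<forall>M. M \<lhd> G \<and> \<not> p dvd card M \<longrightarrow> M \<subseteq> N)"
      using N max by simp
    show "K = N" if "K \<lhd> G \<and> \<not> p dvd card K \<and> (\<forall>M. M \<lhd> G \<and> \<not> p dvd card M \<longrightarrow> M \<subseteq> K)" for K
      using that N max by (intro subset_antisym) simp_all
  qed
  then show "p'_core p G \<lhd> G" "\<not> p dvd card (p'_core p G)"
    "\<And>M. M \<lhd> G \<Longrightarrow> \<not> p dvd card M \<Longrightarrow> M \<subseteq> p'_core p G"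
    using N max by simp_all
qed


subsection \<open>\<^term>\<open>Out_col G\<close> is a group\<close>

lemma Aut_col_subset: "Aut_col G \<subseteq> auto G"
  by (auto simp: Aut_col_def)

context group
begin

lemma AutoGroup_simps:
  "carrier (AutoGroup G) = auto G"
  "\<one>\<^bsub>AutoGroup G\<^esub> = (\<lambda>x\<in>carrier G. x)"
  "\<sigma> \<in> auto G \<Longrightarrow> \<tau> \<in> auto G \<Longrightarrow> \<sigma> \<otimes>\<^bsub>AutoGroup G\<^esub> \<tau> = compose (carrier G) \<sigma> \<tau>"
  by (auto simp: AutoGroup_def BijGroup_def auto_def)

lemma autoD:
  assumes "\<sigma> \<in> auto G"
  shows "x \<in> carrier G \<Longrightarrow> \<sigma> x \<in> carrier G"
    and "x \<in> carrier G \<Longrightarrow> y \<in> carrier G \<Longrightarrow> \<sigma> (x \<otimes> y) = \<sigma> x \<otimes> \<sigma> y"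
    and "x \<in> carrier G \<Longrightarrow> \<sigma> (inv x) = inv (\<sigma> x)"
    and "bij_betw \<sigma> (carrier G) (carrier G)"
    and "\<sigma> \<in> extensional (carrier G)"
proof -
  interpret group_hom G G \<sigma>
    using assms by unfold_locales (auto simp: auto_def)
  show "x \<in> carrier G \<Longrightarrow> \<sigma> x \<in> carrier G"
    "x \<in> carrier G \<Longrightarrow> y \<in> carrier G \<Longrightarrow> \<sigma> (x \<otimes> y) = \<sigma> x \<otimes> \<sigma> y"
    "x \<in> carrier G \<Longrightarrow> \<sigma> (inv x) = inv (\<sigma> x)" by auto
  show "bij_betw \<sigma> (carrier G) (carrier G)" "\<sigma> \<in> extensional (carrier G)"
    using assms by (auto simp: auto_def Bij_def)
qed

lemma inv_AutoGroup:
  assumes "\<sigma> \<in> auto G"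
  shows "inv\<^bsub>AutoGroup G\<^esub> \<sigma> = (\<lambda>x\<in>carrier G. inv_into (carrier G) \<sigma> x)"
  using assms group.m_inv_consistent[OF group_BijGroup subgroup_auto assms]
  by (simp add: AutoGroup_def inv_BijGroup auto_def)

lemma conj_by_comp:
  assumes "g \<in> carrier G" "h \<in> carrier G" "x \<in> carrier G"
  shows "conj_by G h (conj_by G g x) = conj_by G (g \<otimes> h) x"
  using assms by (simp add: conj_by_def inv_mult_group m_assoc)

lemma conj_by_auto:
  assumes g: "g \<in> carrier G"
  shows "conj_by G g \<in> auto G"
proof -
  have "conj_by G (inv g) (conj_by G g x) = x" "conj_by G g (conj_by G (inv g) x) = x"
    if "x \<in> carrier G" for x
    using g that by (simp_all add: conj_by_comp) (simp_all add: conj_by_def)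
  then have "bij_betw (conj_by G g) (carrier G) (carrier G)"
    using g by (intro bij_betw_byWitness[where f' = "conj_by G (inv g)"]) (auto simp: conj_by_def)
  moreover have "conj_by G g \<in> hom G G"
  proof (rule homI)
    fix x y assume c: "x \<in> carrier G" "y \<in> carrier G"
    have "inv g \<otimes> x \<otimes> g \<otimes> (inv g \<otimes> y \<otimes> g) = inv g \<otimes> x \<otimes> (g \<otimes> inv g) \<otimes> y \<otimes> g"
      using g c by (simp only: m_assoc m_closed inv_closed)
    then show "conj_by G g (x \<otimes> y) = conj_by G g x \<otimes> conj_by G g y"
      using g c by (simp add: conj_by_def m_assoc)
  qed (use g in \<open>simp add: conj_by_def\<close>)
  ultimately show ?thesis by (auto simp: auto_def Bij_def conj_by_def)
qed

lemma sylow_image: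
  assumes "\<sigma> \<in> auto G" "sylow_subgroup p P G"
  shows "sylow_subgroup p (\<sigma> ` P) G"
proof -
  have P: "subgroup P G" using assms by (simp add: sylow_subgroup_def)
  interpret group_hom G G \<sigma>
    using assms by unfold_locales (auto simp: auto_def)
  have "inj_on \<sigma> P"
    using autoD(4)[OF assms(1)] subgroup.subset[OF P] by (meson bij_betw_def inj_on_subset)
  then show ?thesis
    using assms subgroup_img_is_subgroup[OF P] by (simp add: sylow_subgroup_def card_image)
qed

lemma Aut_colD:
  assumes "\<sigma> \<in> Aut_col G" "prime p" "p dvd order G" "sylow_subgroup p P G"
  obtains g where "g \<in> carrier G" "\<And>x. x \<in> P \<Longrightarrow> \<sigma> x = conj_by G g x"
  using assms unfolding Aut_col_def by blast

lemma subgroup_Aut_col: "subgroup (Aut_col G) (AutoGroup G)"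
proof (rule group.subgroupI[OF AutoGroup])
  show "Aut_col G \<subseteq> carrier (AutoGroup G)" by (simp add: AutoGroup_simps Aut_col_subset)
next
  have "\<forall>x\<in>P. (\<lambda>x\<in>carrier G. x) x = conj_by G \<one> x" if "subgroup P G" for P
    using subgroup.subset[OF that] by (auto simp: conj_by_def)
  then have "(\<lambda>x\<in>carrier G. x) \<in> Aut_col G"
    unfolding Aut_col_def sylow_subgroup_def using id_in_auto one_closed by blast
  then show "Aut_col G \<noteq> {}" by blast
next
  fix \<sigma> assume s: "\<sigma> \<in> Aut_col G"
  then have a: "\<sigma> \<in> auto G" using Aut_col_subset by blast
  define \<tau> where "\<tau> = inv\<^bsub>AutoGroup G\<^esub> \<sigma>"
  have t: "\<tau> = (\<lambda>x\<in>carrier G. inv_into (carrier G) \<sigma> x)"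
    using a by (simp add: \<tau>_def inv_AutoGroup)
  have ta: "\<tau> \<in> auto G"
    unfolding \<tau>_def using a group.inv_closed[OF AutoGroup] by (simp add: AutoGroup_simps)
  have st: "\<sigma> (\<tau> x) = x" if "x \<in> carrier G" for x
    using that autoD(4)[OF a] by (simp add: t bij_betw_inv_into_right)
  have "\<exists>g\<in>carrier G. \<forall>x\<in>P. \<tau> x = conj_by G g x"
    if H: "prime p" "p dvd order G" "sylow_subgroup p P G" for p P
  proof -
    obtain h where h: "h \<in> carrier G" "\<And>y. y \<in> \<tau> ` P \<Longrightarrow> \<sigma> y = conj_by G h y"
      using Aut_colD[OF s H(1,2) sylow_image[OF ta H(3)]] by metis
    have "\<tau> x = conj_by G (inv h) x" if "x \<in> P" for x
    proof -
      have x: "x \<in> carrier G"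
        using that H(3) subgroup.subset by (auto simp: sylow_subgroup_def)
      have "conj_by G h (\<tau> x) = x" using h(2)[OF imageI[OF that]] st[OF x] by simp
      then have "conj_by G (inv h) x = conj_by G (inv h) (conj_by G h (\<tau> x))" by simp
      also have "\<dots> = \<tau> x"
        using h autoD(1)[OF ta x] by (simp add: conj_by_comp) (simp add: conj_by_def)
      finally show ?thesis by simp
    qed
    then show ?thesis using h(1) by blast
  qed
  then show "inv\<^bsub>AutoGroup G\<^esub> \<sigma> \<in> Aut_col G" using ta by (auto simp: Aut_col_def \<tau>_def)
next
  fix \<sigma> \<tau> assume s: "\<sigma> \<in> Aut_col G" and t: "\<tau> \<in> Aut_col G"
  then have a: "\<sigma> \<in> auto G" "\<tau> \<in> auto G" using Aut_col_subset by blast+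
  have c: "compose (carrier G) \<sigma> \<tau> \<in> auto G"
    using monoid.m_closed[OF group.is_monoid[OF AutoGroup], of \<sigma> \<tau>] a
    by (simp add: AutoGroup_simps)
  have "\<exists>g\<in>carrier G. \<forall>x\<in>P. compose (carrier G) \<sigma> \<tau> x = conj_by G g x"
    if H: "prime p" "p dvd order G" "sylow_subgroup p P G" for p P
  proof -
    obtain g where g: "g \<in> carrier G" "\<And>x. x \<in> P \<Longrightarrow> \<tau> x = conj_by G g x"
      using Aut_colD[OF t H] by metis
    obtain h where h: "h \<in> carrier G" "\<And>x. x \<in> \<tau> ` P \<Longrightarrow> \<sigma> x = conj_by G h x"
      using Aut_colD[OF s H(1,2) sylow_image[OF a(2) H(3)]] by metis
    have "compose (carrier G) \<sigma> \<tau> x = conj_by G (g \<otimes> h) x" if "x \<in> P" for x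
    proof -
      have x: "x \<in> carrier G"
        using that H(3) subgroup.subset by (auto simp: sylow_subgroup_def)
      then show ?thesis
        using g(2)[OF that] h(2)[OF imageI[OF that]] conj_by_comp[OF g(1) h(1) x]
        by (simp add: compose_eq)
    qed
    then show ?thesis using g(1) h(1) by blast
  qed
  then have "compose (carrier G) \<sigma> \<tau> \<in> Aut_col G" using c by (auto simp: Aut_col_def)
  then show "\<sigma> \<otimes>\<^bsub>AutoGroup G\<^esub> \<tau> \<in> Aut_col G" using a by (simp add: AutoGroup_simps)
qed

lemma Inn_subset_Aut_col: "Inn G \<subseteq> Aut_col G"
  by (auto simp: Inn_def Aut_col_def conj_by_auto)

lemma group_AutColGroup: "group (AutColGroup G)"
  unfolding AutColGroup_def
  using subgroup.subgroup_is_group[OF subgroup_Aut_col AutoGroup] .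

lemma conj_by_mult:
  assumes "g \<in> carrier G" "h \<in> carrier G"
  shows "conj_by G h \<otimes>\<^bsub>AutoGroup G\<^esub> conj_by G g = conj_by G (g \<otimes> h)"
proof
  fix x
  show "(conj_by G h \<otimes>\<^bsub>AutoGroup G\<^esub> conj_by G g) x = conj_by G (g \<otimes> h) x"
  proof (cases "x \<in> carrier G")
    case True
    then show ?thesis
      using assms by (simp add: AutoGroup_simps conj_by_auto compose_eq conj_by_comp)
  next
    case False
    then show ?thesis
      using assms by (simp add: AutoGroup_simps conj_by_auto compose_def) (simp add: conj_by_def)
  qed
qed

lemma normal_Inn: "Inn G \<lhd> AutColGroup G"
proof -
  interpret A: group "AutoGroup G" by (rule AutoGroup)
  have one: "conj_by G \<one> = \<one>\<^bsub>AutoGroup G\<^esub>"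
    by (auto simp: AutoGroup_simps conj_by_def)
  have inv: "inv\<^bsub>AutoGroup G\<^esub> conj_by G g = conj_by G (inv g)" if "g \<in> carrier G" for g
    using that by (intro A.inv_equality) (simp_all add: conj_by_mult one conj_by_auto AutoGroup_simps(1))
  have "subgroup (Inn G) (AutoGroup G)"
  proof (rule A.subgroupI)
    show "Inn G \<subseteq> carrier (AutoGroup G)"
      by (auto simp: AutoGroup_simps Inn_def conj_by_auto)
  qed (auto simp: Inn_def inv conj_by_mult)
  then have sub: "subgroup (Inn G) (AutColGroup G)"
    unfolding AutColGroup_def
    by (rule A.subgroup_incl[OF _ subgroup_Aut_col Inn_subset_Aut_col])
  show ?thesis
    unfolding group.normal_inv_iff[OF group_AutColGroup]
  proof (intro conjI sub ballI)
    fix \<sigma> \<tau> assume s: "\<sigma> \<in> carrier (AutColGroup G)" and "\<tau> \<in> Inn G"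
    then obtain g where g: "g \<in> carrier G" "\<tau> = conj_by G g" by (auto simp: Inn_def)
    have sc: "\<sigma> \<in> Aut_col G" using s by (simp add: AutColGroup_def)
    then have a: "\<sigma> \<in> auto G" using Aut_col_subset by blast
    have i: "inv\<^bsub>AutColGroup G\<^esub> \<sigma> = inv\<^bsub>AutoGroup G\<^esub> \<sigma>"
      unfolding AutColGroup_def using A.m_inv_consistent[OF subgroup_Aut_col sc] .
    have "\<sigma> \<otimes>\<^bsub>AutoGroup G\<^esub> conj_by G g = conj_by G (\<sigma> g) \<otimes>\<^bsub>AutoGroup G\<^esub> \<sigma>"
    proof
      fix x
      show "(\<sigma> \<otimes>\<^bsub>AutoGroup G\<^esub> conj_by G g) x = (conj_by G (\<sigma> g) \<otimes>\<^bsub>AutoGroup G\<^esub> \<sigma>) x"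
        using a g by (simp add: AutoGroup_simps(3) conj_by_auto autoD(1)[OF a] compose_def)
          (simp add: autoD(1-3)[OF a] conj_by_def)
    qed
    moreover have "conj_by G (\<sigma> g) \<otimes>\<^bsub>AutoGroup G\<^esub> \<sigma> \<otimes>\<^bsub>AutoGroup G\<^esub> inv\<^bsub>AutoGroup G\<^esub> \<sigma> = conj_by G (\<sigma> g)"
    proof -
      have c: "conj_by G (\<sigma> g) \<in> carrier (AutoGroup G)" "\<sigma> \<in> carrier (AutoGroup G)"
        using a g by (simp_all add: AutoGroup_simps(1) conj_by_auto autoD(1)[OF a])
      show ?thesis
        unfolding A.m_assoc[OF c A.inv_closed[OF c(2)]] A.r_inv[OF c(2)] by (rule A.r_one[OF c(1)])
    qed
    ultimately have eq: "\<sigma> \<otimes>\<^bsub>AutoGroup G\<^esub> \<tau> \<otimes>\<^bsub>AutoGroup G\<^esub> inv\<^bsub>AutoGroup G\<^esub> \<sigma> = conj_by G (\<sigma> g)"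
      by (simp only: g(2))
    show "\<sigma> \<otimes>\<^bsub>AutColGroup G\<^esub> \<tau> \<otimes>\<^bsub>AutColGroup G\<^esub> inv\<^bsub>AutColGroup G\<^esub> \<sigma> \<in> Inn G"
    proof -
      have m: "x \<otimes>\<^bsub>AutColGroup G\<^esub> y = x \<otimes>\<^bsub>AutoGroup G\<^esub> y" for x y
        by (simp add: AutColGroup_def)
      have "conj_by G (\<sigma> g) \<in> Inn G"
        unfolding Inn_def using autoD(1)[OF a g(1)] by (rule imageI)
      with eq show ?thesis by (simp only: i m)
    qed
  qed
qed

lemma group_Out_col: "group (Out_col G)"
  unfolding Out_col_def by (rule normal.factorgroup_is_group[OF normal_Inn])

end

end

theory Submission
  imports Defs "HOL-Algebra.Weak_Morphisms"
begin

text \<open>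
  The hypothesis already covers every finite group with a unique minimal normal subgroup, for a
  suitable prime. Let \<open>N\<close> be the unique minimal normal subgroup of \<open>G\<close> and let \<open>p\<close> be any prime
  divisor of the order of \<open>N\<close>. A non-trivial normal subgroup of \<open>G\<close> contains a minimal one, which
  can only be \<open>N\<close>, so by Lagrange its order is divisible by \<open>p\<close>
  (\<open>unique_minimal_normal_imp_prime\<close>). Hence the \<open>p'\<close>-core of \<open>G\<close> is trivial.

  What remains is a matter of types: the hypothesis speaks of groups of natural numbers. A finite
  group is isomorphic to such a group (\<open>finite_group_iso_nat\<close>), and an isomorphism carries normal
  subgroups, Sylow subgroups and conjugations along. So it transports the triviality of the core in
  one direction, and the triviality of \<^term>\<open>Out_col\<close>, in the form that every Coleman automorphism
  is inner, back in the other.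
\<close>

lemma (in group) card_subgroup_dvd:
  assumes "subgroup N G" "subgroup K G" "N \<subseteq> K"
  shows "card N dvd card K"
proof -
  interpret K: group "G\<lparr>carrier := K\<rparr>" using assms(2) by (rule subgroup_imp_group)
  show ?thesis
    using K.lagrange[OF subgroup_incl[OF assms]]
    by (simp add: order_def) (metis dvd_triv_right)
qed

lemma (in group) minimal_normal_below:
  assumes "finite (carrier G)" "K \<lhd> G" "K \<noteq> {\<one>}"
  obtains M where "minimal_normal M G" "M \<subseteq> K"
proof -
  let ?S = "{M. M \<lhd> G \<and> M \<noteq> {\<one>}}"
  have "?S \<subseteq> Pow (carrier G)" by (auto dest!: normal_imp_subgroup subgroup.subset)
  then have "finite ?S" using assms(1) by (meson finite_Pow_iff finite_subset)
  then obtain M where "M \<in> ?S" "M \<subseteq> K" "\<forall>L\<in>?S. L \<subseteq> M \<longrightarrow> M = L"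
    using finite_has_minimal2[of ?S K] assms(2,3) by auto
  then show thesis by (intro that) (auto simp: minimal_normal_def)
qed

text \<open>Every non-trivial normal subgroup contains the unique minimal one, so any prime divisor of
  the order of the latter works.\<close>

lemma (in group) unique_minimal_normal_imp_prime:
  assumes fin: "finite (carrier G)" and uniq: "\<exists>!N. minimal_normal N G"
  obtains p where "prime p" "\<And>K. K \<lhd> G \<Longrightarrow> \<not> p dvd card K \<Longrightarrow> K = {\<one>}"
proof -
  obtain N where N: "minimal_normal N G" using uniq by blast
  then have sub: "subgroup N G" and nontriv: "N \<noteq> {\<one>}"
    by (simp_all add: minimal_normal_def normal_imp_subgroup)
  have "card N \<noteq> 1"
    using subgroup.one_closed[OF sub] nontriv by (auto simp: card_1_singleton_iff)
  then obtain p where p: "prime p" "p dvd card N" using prime_factor_nat by blast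
  have "p dvd card K" if K: "K \<lhd> G" "K \<noteq> {\<one>}" for K
  proof -
    obtain M where M: "minimal_normal M G" "M \<subseteq> K" using minimal_normal_below[OF fin K] .
    have "M = N" using uniq N M(1) by blast
    then show ?thesis
      using p(2) card_subgroup_dvd[OF sub normal_imp_subgroup[OF K(1)]] M(2) dvd_trans by blast
  qed
  then show thesis using that p(1) by blast
qed

text \<open>The group structure is pushed forward along an injection of the carrier into the naturals. An
  injective map is a weak morphism with respect to the trivial subgroup, because
  \<open>a \<otimes> inv b = \<one>\<close> only if \<open>a = b\<close>.\<close>

lemma (in group) finite_group_iso_nat:
  assumes "finite (carrier G)"
  obtains H :: "nat monoid" and \<phi> where "group H" "\<phi> \<in> iso G H"
proof -
  obtain \<phi> :: "'a \<Rightarrow> nat" where inj: "inj_on \<phi> (carrier G)"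
    using finite_imp_inj_to_nat_seg[OF assms] by blast
  have "\<phi> a = \<phi> b \<longleftrightarrow> a \<otimes> inv b \<in> {\<one>}" if "a \<in> carrier G" "b \<in> carrier G" for a b
    using that inj_on_eq_iff[OF inj that] inv_equality[of a "inv b"] by auto
  then have weak: "weak_group_morphism \<phi> {\<one>} G"
    by (rule weak_group_morphismsI[OF one_is_normal])
  have "\<phi> \<in> iso G (image_group \<phi> G)"
    using weak_group_morphism_is_hom[OF weak] inj
    by (simp add: iso_def bij_betw_def image_group_carrier)
  then show thesis using that image_group_is_group[OF weak] by blast
qed

lemma sylow_subgroup_iso_image:
  assumes grp: "group G" "group H" and iso: "\<phi> \<in> iso G H" and P: "sylow_subgroup p P G"
  shows "sylow_subgroup p (\<phi> ` P) H"
proof -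
  have bij: "bij_betw \<phi> (carrier G) (carrier H)" using iso by (simp add: iso_def)
  interpret group_hom G H \<phi>
    using grp iso by (simp add: group_hom_def group_hom_axioms_def iso_def)
  have sub: "subgroup P G" using P by (simp add: sylow_subgroup_def)
  have "inj_on \<phi> P"
    using bij subgroup.subset[OF sub] by (meson bij_betw_def inj_on_subset)
  moreover have "order H = order G" using bij_betw_same_card[OF bij] by (simp add: order_def)
  ultimately show ?thesis
    using P subgroup_img_is_subgroup[OF sub] by (simp add: sylow_subgroup_def card_image)
qed

lemma (in group_hom) hom_conj_by:
  assumes "g \<in> carrier G" "x \<in> carrier G"
  shows "h (conj_by G g x) = conj_by H (h g) (h x)"
  using assms by (simp add: conj_by_def)

text \<open>Let \<open>Q\<close> be a Sylow subgroup of \<open>H\<close>. Its preimage is a Sylow subgroup of \<open>G\<close>, on which \<open>\<sigma>\<close> is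
  conjugation by some \<open>g\<close>; the transported map is then conjugation by \<open>\<phi> g\<close> on \<open>Q\<close>.\<close>

lemma Aut_col_iso_transport:
  assumes grp: "group G" "group H" and iso: "\<phi> \<in> iso G H" and \<sigma>: "\<sigma> \<in> Aut_col G"
  shows "(\<lambda>y\<in>carrier H. \<phi> (\<sigma> (inv_into (carrier G) \<phi> y))) \<in> Aut_col H"
proof -
  define \<psi> where "\<psi> = inv_into (carrier G) \<phi>"
  define \<tau> where "\<tau> = (\<lambda>y\<in>carrier H. \<phi> (\<sigma> (\<psi> y)))"
  interpret G: group G by fact
  interpret H: group H by fact
  have iso': "\<psi> \<in> iso H G" unfolding \<psi>_def by (rule G.iso_set_sym[OF iso])
  have a: "\<sigma> \<in> auto G" using \<sigma> Aut_col_subset by blast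
  have bij: "bij_betw \<phi> (carrier G) (carrier H)" "bij_betw \<psi> (carrier H) (carrier G)"
    using iso iso' by (simp_all add: iso_def)
  interpret \<phi>: group_hom G H \<phi>
    using iso by unfold_locales (simp add: iso_def)
  interpret \<psi>: group_hom H G \<psi>
    using iso' by unfold_locales (simp add: iso_def)
  have \<phi>\<psi>: "\<phi> (\<psi> y) = y" if "y \<in> carrier H" for y
    using that bij(1) by (simp add: \<psi>_def bij_betw_inv_into_right)
  have "bij_betw (\<phi> \<circ> (\<sigma> \<circ> \<psi>)) (carrier H) (carrier H)"
    using bij G.autoD(4)[OF a] by (blast intro: bij_betw_trans)
  then have "bij_betw \<tau> (carrier H) (carrier H)"
    using bij_betw_cong[of "carrier H" \<tau> "\<phi> \<circ> (\<sigma> \<circ> \<psi>)"] by (simp add: \<tau>_def)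
  moreover have "\<tau> \<in> hom H H"
    by (rule homI) (simp_all add: \<tau>_def G.autoD[OF a])
  ultimately have auto: "\<tau> \<in> auto H" by (simp add: auto_def Bij_def \<tau>_def)
  have "\<exists>h\<in>carrier H. \<forall>y\<in>Q. \<tau> y = conj_by H h y"
    if p: "prime p" "p dvd order H" and Q: "sylow_subgroup p Q H" for p Q
  proof -
    have "p dvd order G" using p(2) bij_betw_same_card[OF bij(1)] by (simp add: order_def)
    then obtain g where g: "g \<in> carrier G" "\<And>x. x \<in> \<psi> ` Q \<Longrightarrow> \<sigma> x = conj_by G g x"
      using G.Aut_colD[OF \<sigma> p(1) _ sylow_subgroup_iso_image[OF grp(2,1) iso' Q]] by metis
    have "\<tau> y = conj_by H (\<phi> g) y" if y: "y \<in> Q" for y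
    proof -
      have c: "y \<in> carrier H"
        using y Q subgroup.subset by (auto simp: sylow_subgroup_def)
      then have "\<tau> y = \<phi> (conj_by G g (\<psi> y))" using g(2) y by (simp add: \<tau>_def)
      then show ?thesis using c g(1) by (simp add: \<phi>.hom_conj_by \<phi>\<psi>)
    qed
    then show ?thesis using g(1) by (intro bexI[of _ "\<phi> g"]) simp_all
  qed
  then have "\<tau> \<in> Aut_col H" using auto by (auto simp: Aut_col_def)
  then show ?thesis unfolding \<tau>_def \<psi>_def .
qed

lemma (in group) trivial_Out_col_iff: "trivial_group (Out_col G) \<longleftrightarrow> Aut_col G \<subseteq> Inn G"
proof -
  interpret A: group "AutColGroup G" by (rule group_AutColGroup)
  interpret I: normal "Inn G" "AutColGroup G" by (rule normal_Inn)
  have carr: "carrier (AutColGroup G) = Aut_col G" by (simp add: AutColGroup_def)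
  have "trivial_group (Out_col G) \<longleftrightarrow> rcosets\<^bsub>AutColGroup G\<^esub> Inn G = {Inn G}"
    using group_Out_col by (simp add: trivial_group_def Out_col_def FactGroup_def)
  also have "\<dots> \<longleftrightarrow> Aut_col G \<subseteq> Inn G"
  proof
    assume "rcosets\<^bsub>AutColGroup G\<^esub> Inn G = {Inn G}"
    then have "Inn G #>\<^bsub>AutColGroup G\<^esub> \<sigma> = Inn G" if "\<sigma> \<in> Aut_col G" for \<sigma>
      using that A.rcosetsI[OF I.subset] carr by blast
    then show "Aut_col G \<subseteq> Inn G" using A.coset_join1[OF _ _ I.subgroup_axioms] carr by blast
  next
    assume "Aut_col G \<subseteq> Inn G"
    then have "Inn G = carrier (AutColGroup G)" using I.subset carr by blast
    then have "Inn G #>\<^bsub>AutColGroup G\<^esub> \<sigma> = Inn G" if "\<sigma> \<in> carrier (AutColGroup G)" for \<sigma>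
      using that A.coset_join2[OF that I.subgroup_axioms] by simp
    then show "rcosets\<^bsub>AutColGroup G\<^esub> Inn G = {Inn G}"
      using I.subgroup_in_rcosets[OF A.group_axioms] by (auto simp: RCOSETS_def)
  qed
  finally show ?thesis .
qed

text \<open>A Coleman automorphism of \<open>G\<close> becomes one of \<open>H\<close>, which is conjugation by some \<open>h\<close>; so the
  original one is conjugation by the preimage of \<open>h\<close>.\<close>

lemma trivial_Out_col_iso:
  assumes grp: "group G" "group H" and iso: "\<phi> \<in> iso G H"
    and triv: "trivial_group (Out_col H)"
  shows "trivial_group (Out_col G)"
proof -
  define \<psi> where "\<psi> = inv_into (carrier G) \<phi>"
  interpret G: group G by fact
  interpret H: group H by fact
  have iso': "\<psi> \<in> iso H G" unfolding \<psi>_def by (rule G.iso_set_sym[OF iso])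
  interpret \<phi>: group_hom G H \<phi>
    using iso by unfold_locales (simp add: iso_def)
  interpret \<psi>: group_hom H G \<psi>
    using iso' by unfold_locales (simp add: iso_def)
  have \<psi>\<phi>: "\<psi> (\<phi> x) = x" if "x \<in> carrier G" for x
    using that iso by (simp add: \<psi>_def iso_def bij_betw_inv_into_left)
  have "\<sigma> \<in> Inn G" if \<sigma>: "\<sigma> \<in> Aut_col G" for \<sigma>
  proof -
    have a: "\<sigma> \<in> auto G" using \<sigma> Aut_col_subset by blast
    have "(\<lambda>y\<in>carrier H. \<phi> (\<sigma> (\<psi> y))) \<in> Inn H"
      using Aut_col_iso_transport[OF grp iso \<sigma>] triv by (auto simp: H.trivial_Out_col_iff \<psi>_def)
    then obtain h where h: "h \<in> carrier H" "(\<lambda>y\<in>carrier H. \<phi> (\<sigma> (\<psi> y))) = conj_by H h"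
      by (auto simp: Inn_def)
    have "\<sigma> = conj_by G (\<psi> h)"
    proof (rule extensionalityI[OF G.autoD(5)[OF a]])
      show "conj_by G (\<psi> h) \<in> extensional (carrier G)" by (simp add: conj_by_def)
      fix x assume x: "x \<in> carrier G"
      have "\<phi> (\<sigma> x) = conj_by H h (\<phi> x)"
        using x fun_cong[OF h(2), of "\<phi> x"] by (simp add: \<psi>\<phi>)
      then have "\<psi> (\<phi> (\<sigma> x)) = \<psi> (conj_by H h (\<phi> x))" by simp
      then show "\<sigma> x = conj_by G (\<psi> h) x"
        using x h(1) by (simp add: \<psi>.hom_conj_by \<psi>\<phi> G.autoD(1)[OF a])
    qed
    then show ?thesis using h(1) by (auto simp: Inn_def)
  qed
  then show ?thesis by (auto simp: G.trivial_Out_col_iff)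
qed

theorem proposition2p10:
  fixes G :: "('a, 'b) monoid_scheme"
  assumes "\<forall>p (H :: nat monoid).
      prime p \<and> group H \<and> finite (carrier H) \<and> p'_core p H = {\<one>\<^bsub>H\<^esub>} \<longrightarrow>
      trivial_group (Out_col H)"
    and "group G" and "finite (carrier G)"
    and "\<exists>!N. minimal_normal N G"
  shows "trivial_group (Out_col G)"
proof -
  interpret G: group G by fact
  obtain p where p: "prime p" and core: "\<And>K. K \<lhd> G \<Longrightarrow> \<not> p dvd card K \<Longrightarrow> K = {\<one>\<^bsub>G\<^esub>}"
    using G.unique_minimal_normal_imp_prime[OF assms(3,4)] by metis
  obtain H :: "nat monoid" and \<phi> where H: "group H" and iso: "\<phi> \<in> iso G H"
    using G.finite_group_iso_nat[OF assms(3)] by metis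
  interpret H: group H by fact
  define \<psi> where "\<psi> = inv_into (carrier G) \<phi>"
  have iso': "\<psi> \<in> iso H G" unfolding \<psi>_def by (rule G.iso_set_sym[OF iso])
  then have inj: "inj_on \<psi> (carrier H)" by (simp add: iso_def bij_betw_def)
  have fin: "finite (carrier H)"
    using assms(3) iso by (auto simp: iso_def dest: bij_betw_finite)
  note C = H.p'_core(1,2)[OF fin p]
  \<comment> \<open>The core of \<open>H\<close> is pulled back to \<open>G\<close>, where it is a normal subgroup of order prime to \<open>p\<close>.\<close>
  have sub: "p'_core p H \<subseteq> carrier H" by (rule subgroup.subset[OF normal_imp_subgroup[OF C(1)]])
  have "card (\<psi> ` p'_core p H) = card (p'_core p H)"
    using inj sub by (meson card_image inj_on_subset)
  then have "\<psi> ` p'_core p H = {\<one>\<^bsub>G\<^esub>}"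
    using core iso_normal_subgroup[OF iso' H assms(2) C(1)] C(2) by simp
  also have "\<dots> = \<psi> ` {\<one>\<^bsub>H\<^esub>}"
    using hom_one[of \<psi> H G] iso' H assms(2) by (simp add: iso_def)
  finally have "p'_core p H = {\<one>\<^bsub>H\<^esub>}"
    using inj_on_image_eq_iff[OF inj sub, of "{\<one>\<^bsub>H\<^esub>}"] by simp
  then have "trivial_group (Out_col H)" using assms(1) p H fin by blast
  then show ?thesis by (rule trivial_Out_col_iso[OF assms(2) H iso])
qed

end
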